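(* Let $\mathsf{AP}$ be a finite set of atomic propositions and let $\varphi,\psi$ be $\mathsf{LTL}_{\hat{\mathsf{F}},\land,\lor,\top,\bot}[\mathsf{AP}]$-formulas. Then $[\![\varphi]\!]=[\![\psi]\!]$ if and only if $[\![\varphi]\!]\cap\mathcal{W}^{\mathsf{fin}}=[\![\psi]\!]\cap\mathcal{W}^{\mathsf{fin}}$. The same equivalence holds for any two $\mathsf{LTL}_{\mathsf{X},\land,\neg}[\mathsf{AP}]$-formulas $\varphi,\psi$.
   Context: Words: for a countable ordinal $\alpha$, an $\alpha$-word is a function $w:\alpha\to\mathcal{P}(\mathsf{AP})$; $|w|=\alpha$; for $\beta<|w|$, $w[\beta..]$ is the suffix $w'$ with $w'[\gamma]=w[\beta+\gamma]$ (of length the unique $\gamma_0$ with $\beta+\gamma_0=|w|$). $\mathcal{W}^{\mathsf{fin}}$ is the set of words of finite length. Semantics: $w\models\top$ always, $w\not\models\bot$; $w\models p$ iff $p\in w[0]$; $\neg,\land,\lor$ as usual; $w\models\mathsf{X}\varphi$ iff $|w|>1$ and $w[1..]\models\varphi$; $w\models\mathsf{F}\varphi$ iff there is $\alpha<|w|$ with $w[\alpha..]\models\varphi$; $\hat{\mathsf{F}}\varphi$ abbreviates $\mathsf{X}\mathsf{F}\varphi$. For a set $O$ of connectives, $\mathsf{LTL}_O[\mathsf{AP}]$ is the set of formulas built from atomic propositions in $\mathsf{AP}$ using only the connectives in $O$. $[\![\varphi]\!]$ is the set of all words of countable ordinal length satisfying $\varphi$. *)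

theory Defs
  imports "HOL-Library.Countable_Set"
begin

unbundle cardinal_syntax

text \<open>\<^const>\<open>cardSuc\<close> is the cardinal successor, represented by an initial well-order. The
  well-order \<open>cardSuc natLeq\<close> is therefore \<open>\<omega>\<^sub>1\<close>, and its elements
  are (representatives of) exactly the countable ordinals, the finite ones and \<open>0\<close> included;
  see \<open>countable_lessThan_cord\<close> and \<open>ex_cord_order_type\<close> below.\<close>

abbreviation omega1 :: "nat set rel" where
  "omega1 \<equiv> cardSuc natLeq"

lemma Card_order_omega1: "Card_order omega1"
  by (rule cardSuc_Card_order[OF natLeq_Card_order])

lemma Well_order_omega1: "Well_order omega1"
  using Card_order_omega1 by (simp add: card_order_on_def)

lemma countable_iff_ordLeq_natLeq: "countable A \<longleftrightarrow> |A| \<le>o natLeq"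
proof -
  have "countable A \<longleftrightarrow> |A| \<le>o |UNIV :: nat set|"
    unfolding countable_def card_of_ordLeq[symmetric] by auto
  also have "\<dots> \<longleftrightarrow> |A| \<le>o natLeq"
    using card_of_nat ordIso_symmetric[OF card_of_nat] ordLeq_ordIso_trans by blast
  finally show ?thesis .
qed

lemma uncountable_Field_omega1: "\<not> countable (Field omega1)"
proof
  assume "countable (Field omega1)"
  then have "|Field omega1| \<le>o natLeq"
    by (simp add: countable_iff_ordLeq_natLeq)
  moreover have "omega1 =o |Field omega1|"
    using card_of_Field_ordIso[OF Card_order_omega1] ordIso_symmetric by blast
  ultimately have "omega1 \<le>o natLeq"
    using ordIso_ordLeq_trans by blast
  with cardSuc_greater[OF natLeq_Card_order] show False
    using not_ordLess_ordLeq by blast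
qed

typedef cord = "Field omega1"
proof -
  have "Field omega1 \<noteq> {}"
    using uncountable_Field_omega1 by auto
  then show ?thesis by auto
qed

instantiation cord :: wellorder
begin

definition less_eq_cord :: "cord \<Rightarrow> cord \<Rightarrow> bool" where
  "\<alpha> \<le> \<beta> \<longleftrightarrow> (Rep_cord \<alpha>, Rep_cord \<beta>) \<in> omega1"

definition less_cord :: "cord \<Rightarrow> cord \<Rightarrow> bool" where
  "\<alpha> < \<beta> \<longleftrightarrow> \<alpha> \<le> \<beta> \<and> \<not> \<beta> \<le> (\<alpha> :: cord)"

instance
proof
  have wo: "refl_on (Field omega1) omega1" "trans omega1" "antisym omega1"
      "total_on (Field omega1) omega1" "wf (omega1 - Id)"
    using Well_order_omega1
    by (auto simp: well_order_on_def linear_order_on_def partial_order_on_def preorder_on_def)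
  fix x y z :: cord
  show "x < y \<longleftrightarrow> x \<le> y \<and> \<not> y \<le> x" by (simp add: less_cord_def)
  show "x \<le> x" using wo(1) Rep_cord[of x] by (auto simp: less_eq_cord_def refl_on_def)
  show "x \<le> z" if "x \<le> y" "y \<le> z" using that wo(2) by (auto simp: less_eq_cord_def dest: transD)
  show "x = y" if "x \<le> y" "y \<le> x"
    using that wo(3) by (auto simp: less_eq_cord_def Rep_cord_inject dest: antisymD)
  show "x \<le> y \<or> y \<le> x"
    using wo(1,4) Rep_cord[of x] Rep_cord[of y] Rep_cord_inject[of x y]
    unfolding less_eq_cord_def refl_on_def total_on_def by metis
  fix P :: "cord \<Rightarrow> bool" and a
  assume step: "\<And>x. (\<And>y. y < x \<Longrightarrow> P y) \<Longrightarrow> P x"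
  have wf': "wf (inv_image (omega1 - Id) Rep_cord)" by (rule wf_inv_image[OF wo(5)])
  show "P a"
  proof (induction a rule: wf_induct_rule[OF wf'])
    case (1 x)
    show ?case
    proof (rule step)
      fix y assume "y < x"
      then have "(y, x) \<in> inv_image (omega1 - Id) Rep_cord"
        by (auto simp: less_cord_def less_eq_cord_def)
      then show "P y" by (rule 1)
    qed
  qed
qed

end

lemma bij_betw_Rep_lessThan_cord: "bij_betw Rep_cord {..<\<alpha>} (underS omega1 (Rep_cord \<alpha>))"
proof -
  have "x \<in> Rep_cord ` {..<\<alpha>}" if "x \<in> underS omega1 (Rep_cord \<alpha>)" for x
  proof -
    have "x \<in> Field omega1" using that by (auto simp: underS_def Field_def)
    then obtain y where "x = Rep_cord y" by (metis Rep_cord_cases)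
    with that show ?thesis
      by (auto simp: underS_def less_eq_cord_def[symmetric] Rep_cord_inject order_less_le)
  qed
  moreover have "Rep_cord x \<in> underS omega1 (Rep_cord \<alpha>)" if "x < \<alpha>" for x
    using that by (auto simp: underS_def order_less_le less_eq_cord_def Rep_cord_inject)
  ultimately show ?thesis
    by (auto simp: bij_betw_def inj_on_def Rep_cord_inject)
qed

lemma countable_lessThan_cord: "countable {..<\<alpha> :: cord}"
proof -
  have "|underS omega1 (Rep_cord \<alpha>)| <o omega1"
    by (rule card_of_underS[OF Card_order_omega1 Rep_cord])
  then have "|underS omega1 (Rep_cord \<alpha>)| \<le>o natLeq"
    using cardSuc_ordLeq_ordLess[OF natLeq_Card_order card_of_Card_order] by blast
  then have "countable (underS omega1 (Rep_cord \<alpha>))"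
    by (simp add: countable_iff_ordLeq_natLeq)
  then show ?thesis
    using bij_betw_Rep_lessThan_cord[of \<alpha>] by (metis bij_betw_def countable_image_inj_on)
qed

lemma uncountable_UNIV_cord: "\<not> countable (UNIV :: cord set)"
proof
  assume "countable (UNIV :: cord set)"
  then have "countable (range Rep_cord)" by (rule countable_image)
  moreover have "range Rep_cord = Field omega1"
    by (rule type_definition.Rep_range[OF type_definition_cord])
  ultimately show False using uncountable_Field_omega1 by simp
qed

lemma ex_cord_order_type:
  assumes r: "well_order_on A r" and A: "countable A"
  shows "\<exists>f \<alpha>. bij_betw f A {..<\<alpha> :: cord} \<and> (\<forall>x\<in>A. \<forall>y\<in>A. (x, y) \<in> r \<longleftrightarrow> f x \<le> f y)"
proof -
  have F: "Field r = A" and W: "Well_order r"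
    using well_order_on_Well_order[OF r] by auto
  have "r <o omega1"
  proof (rule ccontr)
    assume "\<not> r <o omega1"
    then have "omega1 \<le>o r" using W Well_order_omega1 not_ordLess_iff_ordLeq by blast
    then have "|Field omega1| \<le>o |A|" using card_of_mono2 F by blast
    then show False
      using A uncountable_Field_omega1 ordLeq_transitive
      unfolding countable_iff_ordLeq_natLeq by blast
  qed
  then obtain a where a: "a \<in> Field omega1" and iso: "r =o Restr omega1 (underS omega1 a)"
    using ordLess_iff_ordIso_Restr[OF Well_order_omega1 W] by blast
  obtain \<alpha> where \<alpha>: "a = Rep_cord \<alpha>" using a by (metis Rep_cord_cases)
  have FR: "Field (Restr omega1 (underS omega1 a)) = underS omega1 a"
    using Well_order_omega1 by (simp add: Field_Restr_ofilter wo_rel.underS_ofilter wo_rel_def)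
  obtain g where g: "iso r (Restr omega1 (underS omega1 a)) g"
    using iso by (auto simp: ordIso_def)
  have gb: "bij_betw g A (underS omega1 a)"
    and gi: "\<forall>x\<in>A. \<forall>y\<in>A. (x, y) \<in> r \<longleftrightarrow> (g x, g y) \<in> Restr omega1 (underS omega1 a)"
    using g unfolding iso_iff2 F FR by blast+
  define h where "h = inv_into {..<\<alpha>} Rep_cord"
  have h: "bij_betw h (underS omega1 a) {..<\<alpha>}"
    unfolding h_def \<alpha> by (rule bij_betw_inv_into[OF bij_betw_Rep_lessThan_cord])
  have Rh: "Rep_cord (h x) = x" if "x \<in> underS omega1 a" for x
    using that bij_betw_Rep_lessThan_cord[of \<alpha>] unfolding h_def \<alpha>
    by (metis bij_betw_inv_into_right)
  have gA: "g x \<in> underS omega1 a" if "x \<in> A" for x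
    using gb that by (auto simp: bij_betw_def)
  show ?thesis
  proof (intro exI conjI)
    show "bij_betw (h \<circ> g) A {..<\<alpha>}" by (rule bij_betw_trans[OF gb h])
    show "\<forall>x\<in>A. \<forall>y\<in>A. (x, y) \<in> r \<longleftrightarrow> (h \<circ> g) x \<le> (h \<circ> g) y"
      using gi gA Rh by (auto simp: less_eq_cord_def)
  qed
qed

unbundle no cardinal_syntax

lemma ex_cord_greater:
  assumes "countable (A :: cord set)"
  shows "\<exists>\<delta>. \<forall>\<alpha>\<in>A. \<alpha> < \<delta>"
proof -
  have "countable (\<Union>\<alpha>\<in>A. insert \<alpha> {..<\<alpha>})"
    using assms by (simp add: countable_lessThan_cord)
  then obtain \<delta> where "\<delta> \<notin> (\<Union>\<alpha>\<in>A. insert \<alpha> {..<\<alpha>})"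
    using uncountable_UNIV_cord by (metis UNIV_eq_I)
  then show ?thesis by (intro exI[of _ \<delta>]) (auto simp: not_less order_less_le)
qed

text \<open>Ordinal addition by recursion on the second argument, in the uniform form
  \<open>\<beta> + \<gamma> = sup ({\<beta>} \<union> {(\<beta> + \<gamma>') + 1 | \<gamma>' < \<gamma>})\<close>.\<close>

instantiation cord :: "{zero, one, plus}"
begin

definition zero_cord :: cord where
  "0 = (LEAST \<alpha> :: cord. True)"

definition one_cord :: cord where
  "1 = (LEAST \<alpha> :: cord. 0 < \<alpha>)"

function plus_cord :: "cord \<Rightarrow> cord \<Rightarrow> cord" where
  "plus_cord \<beta> \<gamma> = (LEAST \<delta>. \<beta> \<le> \<delta> \<and> (\<forall>\<gamma>'. \<gamma>' < \<gamma> \<longrightarrow> plus_cord \<beta> \<gamma>' < \<delta>))"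
  by auto
termination
  by (relation "inv_image {(x, y). x < y} snd") (auto intro: wf)

declare plus_cord.simps [simp del]

instance ..

end

lemma cord_zero_le [simp]: "0 \<le> (\<alpha> :: cord)"
  unfolding zero_cord_def by (rule Least_le) simp

lemma lessThan_one_cord: "{..<1 :: cord} = {0}"
proof -
  obtain \<delta> :: cord where "0 < \<delta>" using ex_cord_greater[of "{0}"] by auto
  then have "0 < (1 :: cord)" unfolding one_cord_def by (rule LeastI)
  moreover have "\<alpha> = 0" if "\<alpha> < 1" for \<alpha> :: cord
    using that not_less_Least[of \<alpha> "\<lambda>\<alpha>. 0 < \<alpha>"] cord_zero_le[of \<alpha>]
    unfolding one_cord_def by auto
  ultimately show ?thesis by auto
qed

lemma plus_cord_bound:
  "\<beta> \<le> \<beta> + \<gamma> \<and> (\<forall>\<gamma>'<\<gamma>. \<beta> + \<gamma>' < \<beta> + (\<gamma> :: cord))"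
proof -
  have "countable (insert \<beta> ((+) \<beta> ` {..<\<gamma>}))"
    by (simp add: countable_lessThan_cord)
  then obtain \<delta> where "\<forall>\<alpha>\<in>insert \<beta> ((+) \<beta> ` {..<\<gamma>}). \<alpha> < \<delta>"
    using ex_cord_greater by blast
  then have "\<beta> \<le> \<delta> \<and> (\<forall>\<gamma>'. \<gamma>' < \<gamma> \<longrightarrow> \<beta> + \<gamma>' < \<delta>)" by auto
  from LeastI[of "\<lambda>\<delta>. \<beta> \<le> \<delta> \<and> (\<forall>\<gamma>'. \<gamma>' < \<gamma> \<longrightarrow> \<beta> + \<gamma>' < \<delta>)", OF this]
  show ?thesis by (simp add: plus_cord.simps[of \<beta> \<gamma>, symmetric])
qed

lemma plus_cord_least:
  "\<beta> \<le> \<delta> \<Longrightarrow> (\<And>\<gamma>'. \<gamma>' < \<gamma> \<Longrightarrow> \<beta> + \<gamma>' < \<delta>) \<Longrightarrow> \<beta> + \<gamma> \<le> (\<delta> :: cord)"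
  unfolding plus_cord.simps[of \<beta> \<gamma>] by (rule Least_le) auto

lemma plus_cord_zero [simp]: "\<beta> + 0 = (\<beta> :: cord)"
proof (rule antisym)
  show "\<beta> + 0 \<le> \<beta>" by (rule plus_cord_least) (simp_all flip: not_le)
  show "\<beta> \<le> \<beta> + 0" using plus_cord_bound by blast
qed

lemma plus_cord_less_iff [simp]: "\<beta> + \<gamma> < \<beta> + \<gamma>' \<longleftrightarrow> \<gamma> < (\<gamma>' :: cord)"
  using plus_cord_bound by (metis linorder_less_linear order_less_asym)

lemma plus_cord_inject [simp]: "\<beta> + \<gamma> = \<beta> + \<gamma>' \<longleftrightarrow> \<gamma> = (\<gamma>' :: cord)"
  by (metis plus_cord_less_iff linorder_less_linear order_less_irrefl)

lemma ex_cord_diff: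
  assumes "\<beta> \<le> (\<alpha> :: cord)"
  shows "\<exists>!\<gamma>. \<beta> + \<gamma> = \<alpha>"
proof -
  have ge: "\<gamma> \<le> \<beta> + \<gamma>" for \<gamma> :: cord
  proof (induction \<gamma> rule: less_induct)
    case (less \<gamma>)
    show ?case
    proof (rule ccontr)
      assume "\<not> \<gamma> \<le> \<beta> + \<gamma>"
      then have "\<beta> + \<gamma> < \<gamma>" by simp
      with less[OF this] plus_cord_less_iff[of \<beta> "\<beta> + \<gamma>" \<gamma>] show False
        by (metis not_less)
    qed
  qed
  define \<gamma> where "\<gamma> = (LEAST \<gamma>. \<alpha> \<le> \<beta> + \<gamma>)"
  have 1: "\<alpha> \<le> \<beta> + \<gamma>" unfolding \<gamma>_def by (rule LeastI[of _ \<alpha>]) (rule ge)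
  have 2: "\<beta> + \<gamma>' < \<alpha>" if "\<gamma>' < \<gamma>" for \<gamma>'
    using that not_less_Least unfolding \<gamma>_def by (metis not_less)
  have "\<beta> + \<gamma> \<le> \<alpha>" by (rule plus_cord_least[OF assms 2])
  with 1 have "\<beta> + \<gamma> = \<alpha>" by simp
  then show ?thesis by auto
qed

text \<open>An \<open>\<alpha>\<close>-word is a partial map whose domain is the set of ordinals below \<open>\<alpha>\<close>.\<close>

type_synonym 'a oword = "cord \<Rightarrow> 'a set option"

definition words :: "'a set \<Rightarrow> 'a oword set" where
  "words AP = {w. (\<exists>\<alpha>. dom w = {..<\<alpha>}) \<and> ran w \<subseteq> Pow AP}"

definition wlen :: "'a oword \<Rightarrow> cord" where
  "wlen w = (THE \<alpha>. dom w = {..<\<alpha>})"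

definition fin_words :: "'a set \<Rightarrow> 'a oword set" where
  "fin_words AP = {w \<in> words AP. finite {..<wlen w}}"

definition suffix :: "'a oword \<Rightarrow> cord \<Rightarrow> 'a oword" where
  "suffix w \<beta> = (\<lambda>\<gamma>. w (\<beta> + \<gamma>))"

lemma wlen_eq: "dom w = {..<\<alpha>} \<Longrightarrow> wlen w = \<alpha>"
  unfolding wlen_def
  by (rule the_equality) (auto simp: set_eq_iff, metis linorder_less_linear order_less_irrefl)

lemma dom_word: "w \<in> words AP \<Longrightarrow> dom w = {..<wlen w}"
  unfolding words_def by (clarify, simp only: wlen_eq)

lemma suffix_word:
  assumes "w \<in> words AP" "\<beta> \<le> wlen w"
  shows "suffix w \<beta> \<in> words AP" and "\<beta> + wlen (suffix w \<beta>) = wlen w"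
proof -
  obtain \<gamma> where \<gamma>: "\<beta> + \<gamma> = wlen w" using ex_cord_diff[OF assms(2)] by blast
  have "dom (suffix w \<beta>) = {\<delta>. \<beta> + \<delta> \<in> dom w}" by (auto simp: suffix_def)
  also have "\<dots> = {..<\<gamma>}" unfolding dom_word[OF assms(1)] \<gamma>[symmetric] by auto
  finally have d: "dom (suffix w \<beta>) = {..<\<gamma>}" .
  then show "\<beta> + wlen (suffix w \<beta>) = wlen w" using \<gamma> by (simp add: wlen_eq)
  have "ran (suffix w \<beta>) \<subseteq> ran w" by (auto simp: suffix_def ran_def)
  with d assms(1) show "suffix w \<beta> \<in> words AP" by (auto simp: words_def)
qed

datatype 'a ltl =
    Top
  | Bot
  | Prop 'a
  | Neg "'a ltl"
  | And "'a ltl" "'a ltl"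
  | Or "'a ltl" "'a ltl"
  | Next "'a ltl"
  | Fin "'a ltl"

abbreviation Fhat :: "'a ltl \<Rightarrow> 'a ltl" where
  "Fhat \<phi> \<equiv> Next (Fin \<phi>)"

text \<open>The empty word has no letter at position \<open>0\<close>, so it satisfies no atomic proposition.\<close>

primrec sat :: "'a oword \<Rightarrow> 'a ltl \<Rightarrow> bool" (infix "\<Turnstile>" 50) where
  "w \<Turnstile> Top \<longleftrightarrow> True"
| "w \<Turnstile> Bot \<longleftrightarrow> False"
| "w \<Turnstile> Prop p \<longleftrightarrow> (\<exists>A. w 0 = Some A \<and> p \<in> A)"
| "w \<Turnstile> Neg \<phi> \<longleftrightarrow> \<not> w \<Turnstile> \<phi>"
| "w \<Turnstile> And \<phi> \<psi> \<longleftrightarrow> w \<Turnstile> \<phi> \<and> w \<Turnstile> \<psi>"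
| "w \<Turnstile> Or \<phi> \<psi> \<longleftrightarrow> w \<Turnstile> \<phi> \<or> w \<Turnstile> \<psi>"
| "w \<Turnstile> Next \<phi> \<longleftrightarrow> wlen w > 1 \<and> suffix w 1 \<Turnstile> \<phi>"
| "w \<Turnstile> Fin \<phi> \<longleftrightarrow> (\<exists>\<alpha><wlen w. suffix w \<alpha> \<Turnstile> \<phi>)"

datatype connective = CTop | CBot | CNeg | CAnd | COr | CNext | CFin | CFhat

inductive_set LTL :: "connective set \<Rightarrow> 'a set \<Rightarrow> 'a ltl set"
  for C :: "connective set" and AP :: "'a set" where
  "p \<in> AP \<Longrightarrow> Prop p \<in> LTL C AP"
| "CTop \<in> C \<Longrightarrow> Top \<in> LTL C AP"
| "CBot \<in> C \<Longrightarrow> Bot \<in> LTL C AP"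
| "CNeg \<in> C \<Longrightarrow> \<phi> \<in> LTL C AP \<Longrightarrow> Neg \<phi> \<in> LTL C AP"
| "CAnd \<in> C \<Longrightarrow> \<phi> \<in> LTL C AP \<Longrightarrow> \<psi> \<in> LTL C AP \<Longrightarrow> And \<phi> \<psi> \<in> LTL C AP"
| "COr \<in> C \<Longrightarrow> \<phi> \<in> LTL C AP \<Longrightarrow> \<psi> \<in> LTL C AP \<Longrightarrow> Or \<phi> \<psi> \<in> LTL C AP"
| "CNext \<in> C \<Longrightarrow> \<phi> \<in> LTL C AP \<Longrightarrow> Next \<phi> \<in> LTL C AP"
| "CFin \<in> C \<Longrightarrow> \<phi> \<in> LTL C AP \<Longrightarrow> Fin \<phi> \<in> LTL C AP"
| "CFhat \<in> C \<Longrightarrow> \<phi> \<in> LTL C AP \<Longrightarrow> Fhat \<phi> \<in> LTL C AP"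

definition lang :: "'a set \<Rightarrow> 'a ltl \<Rightarrow> 'a oword set" where
  "lang AP \<phi> = {w \<in> words AP. w \<Turnstile> \<phi>}"

end

theory Submission
  imports Defs
begin

text \<open>A negation-free formula over \<^term>\<open>Fhat\<close> is existential: its truth is preserved when a word
  is embedded into a larger one with the same first letter, and its truth in a word is already
  witnessed by finitely many positions. So the subword formed by the first letter and the
  witnesses for \<open>\<phi>\<close> is a finite word that satisfies \<open>\<phi>\<close>, and it satisfies no \<open>\<psi>\<close> that the whole
  word violates. The truth of a formula over \<open>X, \<and>, \<not>\<close> is determined by a finite prefix.\<close>

section \<open>Ordinals and suffixes\<close>

lemma plus_cord_le_iff [simp]: "\<alpha> + \<beta> \<le> \<alpha> + \<gamma> \<longleftrightarrow> \<beta> \<le> (\<gamma> :: cord)"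
  by (metis not_less plus_cord_less_iff)

lemma zero_plus_cord [simp]: "0 + \<gamma> = (\<gamma> :: cord)"
proof (induction \<gamma> rule: less_induct)
  case (less \<gamma>)
  have "0 + \<gamma> \<le> \<gamma>" by (rule plus_cord_least) (simp_all add: less)
  moreover have "\<not> 0 + \<gamma> < \<gamma>" using less plus_cord_inject by (metis order_less_irrefl)
  ultimately show ?case by simp
qed

text \<open>A sum is the least ordinal meeting its lower bounds, so each inequality only needs those
  bounds checked. An ordinal below \<beta> + \<gamma> is either below \<beta> or of the form \<beta>
  + \<epsilon> with \<epsilon> < \<gamma>, where induction applies.\<close>

lemma plus_cord_assoc: "\<alpha> + \<beta> + \<gamma> = \<alpha> + (\<beta> + \<gamma> :: cord)"
proof (induction \<gamma> rule: less_induct)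
  case (less \<gamma>)
  show ?case
  proof (rule antisym)
    have "\<alpha> + \<beta> \<le> \<alpha> + (\<beta> + \<gamma>)"
      using plus_cord_bound[of \<beta> \<gamma>] by simp
    then show "\<alpha> + \<beta> + \<gamma> \<le> \<alpha> + (\<beta> + \<gamma>)"
      by (rule plus_cord_least) (simp add: less)
    show "\<alpha> + (\<beta> + \<gamma>) \<le> \<alpha> + \<beta> + \<gamma>"
    proof (rule plus_cord_least)
      show "\<alpha> \<le> \<alpha> + \<beta> + \<gamma>" using plus_cord_bound by (meson order_trans)
      fix \<delta> assume \<delta>: "\<delta> < \<beta> + \<gamma>"
      show "\<alpha> + \<delta> < \<alpha> + \<beta> + \<gamma>"
      proof (cases "\<delta> < \<beta>")
        case True
        then have "\<alpha> + \<delta> < \<alpha> + \<beta>" by simp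
        also have "\<dots> \<le> \<alpha> + \<beta> + \<gamma>" using plus_cord_bound by blast
        finally show ?thesis .
      next
        case False
        then obtain \<epsilon> where "\<delta> = \<beta> + \<epsilon>" using ex_cord_diff by (metis not_less)
        with \<delta> show ?thesis by (simp flip: less[of \<epsilon>])
      qed
    qed
  qed
qed

lemma one_le_cord_iff: "1 \<le> \<alpha> \<longleftrightarrow> \<alpha> \<noteq> (0 :: cord)"
  using lessThan_one_cord by (metis not_less lessThan_iff singleton_iff)

text \<open>Adding 1 on the right gives the successor. This turns the positions reached by X F from
  \<beta>, those from \<beta> + 1 on, into the positions strictly after \<beta>.\<close>

lemma plus_one_le_cord_iff: "\<alpha> + 1 \<le> \<beta> \<longleftrightarrow> \<alpha> < (\<beta> :: cord)"
proof
  assume "\<alpha> < \<beta>"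
  then obtain \<delta> where \<delta>: "\<beta> = \<alpha> + \<delta>" using ex_cord_diff by (metis order_less_imp_le)
  with \<open>\<alpha> < \<beta>\<close> have "1 \<le> \<delta>" by (auto simp: one_le_cord_iff)
  with \<delta> show "\<alpha> + 1 \<le> \<beta>" by simp
next
  have "\<alpha> < \<alpha> + 1" using plus_cord_less_iff[of \<alpha> 0 1] lessThan_one_cord by auto
  then show "\<alpha> + 1 \<le> \<beta> \<Longrightarrow> \<alpha> < \<beta>" by simp
qed

text \<open>The 1 stands on the left because \<open>suffix w 1\<close> reads \<open>w\<close> at 1 +
  \<gamma>. Every nonzero ordinal has the form 1 + \<delta>, so the segment consists of 0 and a
  shifted copy of the old one.\<close>

lemma finite_lessThan_one_plus_cord:
  assumes "finite {..<\<alpha> :: cord}"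
  shows "finite {..<1 + \<alpha>}"
proof (rule finite_subset)
  show "{..<1 + \<alpha>} \<subseteq> insert 0 ((+) 1 ` {..<\<alpha>})"
  proof
    fix \<beta> assume \<beta>: "\<beta> \<in> {..<1 + \<alpha>}"
    show "\<beta> \<in> insert 0 ((+) 1 ` {..<\<alpha>})"
    proof (cases "\<beta> = 0")
      case False
      then obtain \<delta> where "\<beta> = 1 + \<delta>" using ex_cord_diff[of 1 \<beta>] by (auto simp: one_le_cord_iff)
      with \<beta> show ?thesis by simp
    qed simp
  qed
qed (use assms in simp)

lemma suffix_zero [simp]: "suffix w 0 = w"
  by (simp add: suffix_def)

lemma suffix_suffix: "suffix (suffix w \<alpha>) \<beta> = suffix w (\<alpha> + \<beta>)"
  by (simp add: suffix_def plus_cord_assoc)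

lemma mem_dom_word_iff: "w \<in> words AP \<Longrightarrow> \<alpha> \<in> dom w \<longleftrightarrow> \<alpha> < wlen w"
  using dom_word by blast

lemma suffix_sat_Prop_iff: "suffix w \<beta> \<Turnstile> Prop p \<longleftrightarrow> (\<exists>A. w \<beta> = Some A \<and> p \<in> A)"
  by (simp add: suffix_def)

text \<open>Restating the semantics through absolute positions of one fixed word leaves only the
  order and the domain, which is what an embedding transports.\<close>

lemma suffix_sat_Fhat_iff:
  assumes w: "w \<in> words AP" and \<beta>: "\<beta> \<in> dom w"
  shows "suffix w \<beta> \<Turnstile> Fhat \<phi> \<longleftrightarrow> (\<exists>\<gamma>\<in>dom w. \<beta> < \<gamma> \<and> suffix w \<gamma> \<Turnstile> \<phi>)"
proof -
  have \<beta>': "\<beta> < wlen w" using w \<beta> by (simp add: mem_dom_word_iff)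
  have le: "\<beta> + 1 \<le> wlen w" using \<beta>' by (simp add: plus_one_le_cord_iff)
  have "wlen (suffix w \<beta>) > 1 \<longleftrightarrow> \<beta> + 1 < wlen w"
    using suffix_word(2)[OF w, of \<beta>] \<beta>' by (metis plus_cord_less_iff order_less_imp_le)
  moreover have "\<alpha> < wlen (suffix w (\<beta> + 1)) \<longleftrightarrow> \<beta> + 1 + \<alpha> < wlen w" for \<alpha>
    using suffix_word(2)[OF w le] by (metis plus_cord_less_iff)
  ultimately have "suffix w \<beta> \<Turnstile> Fhat \<phi> \<longleftrightarrow>
      \<beta> + 1 < wlen w \<and> (\<exists>\<alpha>. \<beta> + 1 + \<alpha> < wlen w \<and> suffix w (\<beta> + 1 + \<alpha>) \<Turnstile> \<phi>)"
    by (simp add: suffix_suffix)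
  \<comment> \<open>The length condition of \<open>Next\<close> follows from the existence of any
    witness, since \<beta> + 1 \<le> \<beta> + 1 + \<alpha>.\<close>
  also have "\<dots> \<longleftrightarrow> (\<exists>\<alpha>. \<beta> + 1 + \<alpha> < wlen w \<and> suffix w (\<beta> + 1 + \<alpha>) \<Turnstile> \<phi>)"
    using plus_cord_bound by (meson order_le_less_trans)
  also have "\<dots> \<longleftrightarrow> (\<exists>\<gamma>. \<beta> + 1 \<le> \<gamma> \<and> \<gamma> < wlen w \<and> suffix w \<gamma> \<Turnstile> \<phi>)"
    using ex_cord_diff plus_cord_bound by metis
  also have "\<dots> \<longleftrightarrow> (\<exists>\<gamma>\<in>dom w. \<beta> < \<gamma> \<and> suffix w \<gamma> \<Turnstile> \<phi>)"
    using mem_dom_word_iff[OF w] by (metis plus_one_le_cord_iff)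
  finally show ?thesis .
qed

section \<open>Existential formulas and embeddings\<close>

text \<open>Letters are compared as option values, so the equation also forces
  \<open>f \<alpha>\<close> into \<open>dom w\<close>. The image may have gaps, and 0 need not be
  fixed.\<close>

definition embedding :: "(cord \<Rightarrow> cord) \<Rightarrow> 'a oword \<Rightarrow> 'a oword \<Rightarrow> bool" where
  "embedding f v w \<longleftrightarrow> strict_mono_on (dom v) f \<and> (\<forall>\<alpha>\<in>dom v. w (f \<alpha>) = v \<alpha>)"

lemma embedding_mem_dom: "embedding f v w \<Longrightarrow> \<alpha> \<in> dom v \<Longrightarrow> f \<alpha> \<in> dom w"
  by (force simp: embedding_def)

lemma embedding_less_iff:
  "embedding f v w \<Longrightarrow> \<alpha> \<in> dom v \<Longrightarrow> \<beta> \<in> dom v \<Longrightarrow> f \<alpha> < f \<beta> \<longleftrightarrow> \<alpha> < \<beta>"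
  by (auto simp: embedding_def dest: strict_mono_on_less)

text \<open>Without negation, only \<open>Fhat\<close> changes position: \<open>f\<close> carries
  its witness along and, being strictly increasing, keeps it strictly in the future. An arbitrary
  \<alpha> is needed for the induction to follow the witnesses.\<close>

lemma sat_embedding:
  assumes "\<phi> \<in> LTL {CFhat, CAnd, COr, CTop, CBot} AP"
    and v: "v \<in> words AP" and w: "w \<in> words AP" and f: "embedding f v w"
    and "\<alpha> \<in> dom v" "suffix v \<alpha> \<Turnstile> \<phi>"
  shows "suffix w (f \<alpha>) \<Turnstile> \<phi>"
  using assms(1,5,6)
proof (induction arbitrary: \<alpha>)
  case (1 p)
  then show ?case using f by (auto simp: suffix_sat_Prop_iff embedding_def simp del: sat.simps)
next
  case (9 \<phi>)
  then obtain \<beta> where "\<beta> \<in> dom v" "\<alpha> < \<beta>" "suffix v \<beta> \<Turnstile> \<phi>"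
    using suffix_sat_Fhat_iff[OF v] by blast
  then have "f \<beta> \<in> dom w" "f \<alpha> < f \<beta>" "suffix w (f \<beta>) \<Turnstile> \<phi>"
    using 9 f by (auto simp: embedding_mem_dom embedding_less_iff)
  then show ?case
    using suffix_sat_Fhat_iff[OF w] embedding_mem_dom[OF f \<open>\<alpha> \<in> dom v\<close>] by blast
qed auto

text \<open>\<open>S\<close> collects one witness for each \<open>Fhat\<close> that the evaluation
  meets. It is chosen before \<open>v\<close> and \<open>f\<close>, and the image only has to
  contain it, so enlarging \<open>S\<close> does no harm and the sets for two conjuncts can be
  united.\<close>

lemma sat_finite_witness:
  assumes "\<phi> \<in> LTL {CFhat, CAnd, COr, CTop, CBot} AP"
    and w: "w \<in> words AP" and "\<beta> \<in> dom w" "suffix w \<beta> \<Turnstile> \<phi>"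
  shows "\<exists>S. finite S \<and> S \<subseteq> dom w \<and>
    (\<forall>v\<in>words AP. \<forall>f. embedding f v w \<longrightarrow> S \<subseteq> f ` dom v \<longrightarrow>
       (\<forall>\<alpha>\<in>dom v. f \<alpha> = \<beta> \<longrightarrow> suffix v \<alpha> \<Turnstile> \<phi>))"
    (is "\<exists>S. ?W \<beta> \<phi> S")
  using assms(1,3,4)
proof (induction arbitrary: \<beta>)
  case (1 p)
  have "suffix v \<alpha> \<Turnstile> Prop p"
    if "embedding f v w" "\<alpha> \<in> dom v" "f \<alpha> = \<beta>" for v f \<alpha>
  proof -
    have "v \<alpha> = w \<beta>" using that by (metis embedding_def)
    then show ?thesis using 1 by (simp add: suffix_sat_Prop_iff del: sat.simps)
  qed
  then show ?case by (intro exI[of _ "{}"]) blast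
next
  case 2
  then show ?case by (intro exI[of _ "{}"]) simp
next
  case (5 \<phi> \<psi>)
  have sat: "suffix w \<beta> \<Turnstile> \<phi>" "suffix w \<beta> \<Turnstile> \<psi>" using 5 by simp_all
  obtain S where "?W \<beta> \<phi> S" using "5.IH"(1)[OF \<open>\<beta> \<in> dom w\<close> sat(1)] by (elim exE)
  moreover obtain T where "?W \<beta> \<psi> T" using "5.IH"(2)[OF \<open>\<beta> \<in> dom w\<close> sat(2)] by (elim exE)
  ultimately have "?W \<beta> (And \<phi> \<psi>) (S \<union> T)" by simp
  then show ?case by (rule exI)
next
  case (6 \<phi> \<psi>)
  from \<open>suffix w \<beta> \<Turnstile> Or \<phi> \<psi>\<close> consider "suffix w \<beta> \<Turnstile> \<phi>" | "suffix w \<beta> \<Turnstile> \<psi>" by auto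
  then show ?case
  proof cases
    case 1
    obtain S where "?W \<beta> \<phi> S" using "6.IH"(1)[OF \<open>\<beta> \<in> dom w\<close> 1] by (elim exE)
    then have "?W \<beta> (Or \<phi> \<psi>) S" by simp
    then show ?thesis by (rule exI)
  next
    case 2
    obtain S where "?W \<beta> \<psi> S" using "6.IH"(2)[OF \<open>\<beta> \<in> dom w\<close> 2] by (elim exE)
    then have "?W \<beta> (Or \<phi> \<psi>) S" by simp
    then show ?thesis by (rule exI)
  qed
next
  case (9 \<phi>)
  then obtain \<gamma> where \<gamma>: "\<gamma> \<in> dom w" "\<beta> < \<gamma>" "suffix w \<gamma> \<Turnstile> \<phi>"
    using suffix_sat_Fhat_iff[OF w] by blast
  obtain S where S: "?W \<gamma> \<phi> S" using "9.IH"[OF \<gamma>(1,3)] by (elim exE)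
  have "suffix v \<alpha> \<Turnstile> Fhat \<phi>"
    if v: "v \<in> words AP" and f: "embedding f v w" "insert \<gamma> S \<subseteq> f ` dom v"
      and \<alpha>: "\<alpha> \<in> dom v" "f \<alpha> = \<beta>" for v f \<alpha>
  proof -
    obtain \<delta> where \<delta>: "\<delta> \<in> dom v" "f \<delta> = \<gamma>" using f by blast
    then have "suffix v \<delta> \<Turnstile> \<phi>" using S v f by blast
    moreover have "\<alpha> < \<delta>" using embedding_less_iff[OF f(1) \<alpha>(1) \<delta>(1)] \<alpha> \<delta> \<gamma> by simp
    ultimately show ?thesis using suffix_sat_Fhat_iff[OF v \<alpha>(1)] \<delta> by blast
  qed
  \<comment> \<open>\<open>S\<close> secures \<phi> at \<gamma>; adding \<gamma> itself ensures that
    the subword retains a position to evaluate \<phi> at.\<close>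
  then have "?W \<beta> (Fhat \<phi>) (insert \<gamma> S)" using S \<gamma>(1) by (simp del: sat.simps)
  then show ?case by (rule exI)
qed auto

text \<open>A finite set of positions is well-ordered, so it is order-isomorphic to the ordinals
  below some \<alpha>; reading \<open>w\<close> along the inverse isomorphism gives the
  subword.\<close>

lemma ex_finite_subword:
  assumes w: "w \<in> words AP" and S: "finite S" "S \<subseteq> dom w"
  shows "\<exists>v\<in>fin_words AP. \<exists>f. embedding f v w \<and> f ` dom v = S"
proof -
  define r where "r = {(x, y). x \<in> S \<and> y \<in> S \<and> x \<le> y}"
  have "well_order_on S r"
    unfolding well_order_on_def linear_order_on_def partial_order_on_def preorder_on_def
  proof (intro conjI)
    show "wf (r - Id)" by (rule wf_subset[OF wf]) (auto simp: r_def)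
  qed (auto simp: r_def refl_on_def trans_def antisym_def total_on_def)
  then obtain g and \<alpha> :: cord where g: "bij_betw g S {..<\<alpha>}"
    and mono: "\<forall>x\<in>S. \<forall>y\<in>S. (x, y) \<in> r \<longleftrightarrow> g x \<le> g y"
    using ex_cord_order_type[OF _ countable_finite[OF S(1)]] by blast
  define f where "f = inv_into S g"
  define v where "v = (w \<circ> f) |` {..<\<alpha>}"
  have f: "bij_betw f {..<\<alpha>} S" unfolding f_def by (rule bij_betw_inv_into[OF g])
  have fS: "f \<gamma> \<in> S" "g (f \<gamma>) = \<gamma>" if "\<gamma> < \<alpha>" for \<gamma>
    using that f g unfolding f_def
    by (auto simp: bij_betw_def bij_betw_inv_into_right[OF g] intro: inv_into_into)
  have "f \<gamma> \<in> dom w" if "\<gamma> < \<alpha>" for \<gamma> using fS(1)[OF that] S(2) by blast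
  then have domv: "dom v = {..<\<alpha>}" by (auto simp: v_def dom_def restrict_map_def)
  have "ran v \<subseteq> ran w" by (auto simp: v_def ran_def restrict_map_def split: if_splits)
  then have "v \<in> words AP" using w domv by (auto simp: words_def)
  moreover have "finite {..<\<alpha>}" using bij_betw_finite[OF g] S(1) by blast
  ultimately have "v \<in> fin_words AP" by (simp add: fin_words_def wlen_eq[OF domv])
  moreover have "strict_mono_on {..<\<alpha>} f"
  proof (rule strict_mono_onI)
    fix \<gamma> \<delta> assume "\<gamma> \<in> {..<\<alpha>}" "\<delta> \<in> {..<\<alpha>}" "\<gamma> < \<delta>"
    \<comment> \<open>Otherwise applying \<open>g\<close>, which preserves the order and inverts
      \<open>f\<close>, would give \<delta> \<le> \<gamma>.\<close>
    then have "(f \<delta>, f \<gamma>) \<notin> r" using mono fS by simp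
    with fS \<open>\<gamma> \<in> {..<\<alpha>}\<close> \<open>\<delta> \<in> {..<\<alpha>}\<close> show "f \<gamma> < f \<delta>" by (auto simp: r_def)
  qed
  then have "embedding f v w" by (auto simp: embedding_def domv, simp add: v_def)
  moreover have "f ` dom v = S" using f by (simp add: domv bij_betw_def)
  ultimately show ?thesis by blast
qed

text \<open>The finite subword through the witnesses for \<phi> satisfies \<phi>, hence \<psi> by
  the hypothesis on finite words, and its embedding carries \<psi> back to \<open>w\<close>.\<close>

lemma lang_subset_Fhat:
  assumes \<phi>: "\<phi> \<in> LTL {CFhat, CAnd, COr, CTop, CBot} AP"
    and \<psi>: "\<psi> \<in> LTL {CFhat, CAnd, COr, CTop, CBot} AP"
    and fin: "lang AP \<phi> \<inter> fin_words AP \<subseteq> lang AP \<psi>"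
  shows "lang AP \<phi> \<subseteq> lang AP \<psi>"
proof
  fix w assume "w \<in> lang AP \<phi>"
  then have w: "w \<in> words AP" and sat: "w \<Turnstile> \<phi>" by (auto simp: lang_def)
  show "w \<in> lang AP \<psi>"
  \<comment> \<open>The empty word has no position 0 at which to start, but it is itself finite, so
    the hypothesis covers it directly.\<close>
  proof (cases "wlen w = 0")
    case True
    then have "{..<wlen w} = {}" using cord_zero_le by (metis lessThan_iff equals0I not_less)
    then have "w \<in> fin_words AP" using w by (simp add: fin_words_def)
    with fin \<open>w \<in> lang AP \<phi>\<close> show ?thesis by blast
  next
    case False
    then have 0: "0 \<in> dom w"
      using w by (simp add: mem_dom_word_iff order_less_le)
    obtain S where S: "finite S" "S \<subseteq> dom w"
      and wit: "\<And>v f \<alpha>. v \<in> words AP \<Longrightarrow> embedding f v w \<Longrightarrow> S \<subseteq> f ` dom v \<Longrightarrow>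
        \<alpha> \<in> dom v \<Longrightarrow> f \<alpha> = 0 \<Longrightarrow> suffix v \<alpha> \<Turnstile> \<phi>"
      using sat_finite_witness[OF \<phi> w 0] sat by auto
    \<comment> \<open>\<open>S\<close> need not contain 0, as for an atomic proposition; inserting 0
      keeps the first letter of \<open>w\<close>.\<close>
    obtain v f where v: "v \<in> fin_words AP" and f: "embedding f v w" "f ` dom v = insert 0 S"
      using ex_finite_subword[OF w, of "insert 0 S"] S 0 by auto
    have vw: "v \<in> words AP" using v by (simp add: fin_words_def)
    have "0 \<in> f ` dom v" using f(2) by simp
    then obtain \<alpha> where \<alpha>: "\<alpha> \<in> dom v" "f \<alpha> = 0" by (metis imageE)
    have v0: "0 \<in> dom v"
      using \<alpha>(1) cord_zero_le[of \<alpha>] unfolding mem_dom_word_iff[OF vw]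
      by (rule order_le_less_trans[rotated])
    \<comment> \<open>If 0 < \<alpha>, then \<open>f 0\<close> < \<open>f \<alpha>\<close> = 0.
      Hence \<open>f\<close> fixes 0, and satisfaction at position 0 is satisfaction by the whole
      words.\<close>
    have "\<not> 0 < \<alpha>"
      using embedding_less_iff[OF f(1) v0 \<alpha>(1)] \<alpha>(2) cord_zero_le[of "f 0"] by (metis not_less)
    then have f0: "f 0 = 0" using \<alpha>(2) by (simp add: order_less_le)
    have "v \<Turnstile> \<phi>" using wit[OF vw f(1) _ v0 f0] f(2) by auto
    then have "v \<Turnstile> \<psi>" using fin v vw by (auto simp: lang_def)
    then have "w \<Turnstile> \<psi>" using sat_embedding[OF \<psi> vw w f(1) v0] f0 by simp
    with w show ?thesis by (simp add: lang_def)
  qed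
qed

section \<open>Next formulas and prefixes\<close>

text \<open>The bound constructed is one more than the nesting depth of \<open>Next\<close>.
  Agreement below \<open>N\<close> includes undefined positions, so it also detects where a word
  ends.\<close>

lemma sat_finite_prefix:
  assumes "\<phi> \<in> LTL {CNext, CAnd, CNeg} AP"
  shows "\<exists>N. finite {..<N} \<and> 0 < N \<and>
    (\<forall>v\<in>words AP. \<forall>w\<in>words AP. (\<forall>\<gamma><N. v \<gamma> = w \<gamma>) \<longrightarrow> (v \<Turnstile> \<phi> \<longleftrightarrow> w \<Turnstile> \<phi>))"
  using assms
proof induction
  case (1 p)
  have "0 < (1 :: cord)" using lessThan_one_cord by auto
  then show ?case by (intro exI[of _ 1]) (simp add: lessThan_one_cord)
next
  case (5 \<phi> \<psi>)
  then obtain M N where M: "finite {..<M}" "0 < M"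
      "\<forall>v\<in>words AP. \<forall>w\<in>words AP. (\<forall>\<gamma><M. v \<gamma> = w \<gamma>) \<longrightarrow> (v \<Turnstile> \<phi> \<longleftrightarrow> w \<Turnstile> \<phi>)"
    and N: "finite {..<N}"
      "\<forall>v\<in>words AP. \<forall>w\<in>words AP. (\<forall>\<gamma><N. v \<gamma> = w \<gamma>) \<longrightarrow> (v \<Turnstile> \<psi> \<longleftrightarrow> w \<Turnstile> \<psi>)"
    by blast
  have "finite {..<max M N}" using M(1) N(1) by (simp add: max_def)
  moreover have "v \<Turnstile> And \<phi> \<psi> \<longleftrightarrow> w \<Turnstile> And \<phi> \<psi>"
    if "v \<in> words AP" "w \<in> words AP" "\<forall>\<gamma><max M N. v \<gamma> = w \<gamma>" for v w
  proof -
    have "\<forall>\<gamma><M. v \<gamma> = w \<gamma>" "\<forall>\<gamma><N. v \<gamma> = w \<gamma>"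
      using that(3) by (metis less_max_iff_disj)+
    then have "v \<Turnstile> \<phi> \<longleftrightarrow> w \<Turnstile> \<phi>" "v \<Turnstile> \<psi> \<longleftrightarrow> w \<Turnstile> \<psi>"
      using M(3) N(2) that(1,2) by blast+
    then show ?thesis by simp
  qed
  moreover have "0 < max M N" using M(2) by (simp add: less_max_iff_disj)
  ultimately show ?case by (intro exI[of _ "max M N"]) blast
next
  case (7 \<phi>)
  then obtain N where N: "finite {..<N}" "0 < N"
      "\<forall>v\<in>words AP. \<forall>w\<in>words AP. (\<forall>\<gamma><N. v \<gamma> = w \<gamma>) \<longrightarrow> (v \<Turnstile> \<phi> \<longleftrightarrow> w \<Turnstile> \<phi>)"
    by blast
  \<comment> \<open>This is where the invariant 0 < \<open>N\<close> enters: the words agree at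
    position 1, so either both or neither have length above 1.\<close>
  have 1: "1 < 1 + N" using N(2) plus_cord_less_iff[of 1 0 N] by simp
  have "v \<Turnstile> Next \<phi> \<longleftrightarrow> w \<Turnstile> Next \<phi>"
    if v: "v \<in> words AP" and w: "w \<in> words AP" and eq: "\<forall>\<gamma><1 + N. v \<gamma> = w \<gamma>" for v w
  proof -
    have "1 \<in> dom v \<longleftrightarrow> 1 \<in> dom w" using eq 1 by (simp add: domIff)
    then have "1 < wlen v \<longleftrightarrow> 1 < wlen w" using v w by (simp add: mem_dom_word_iff)
    moreover have "suffix v 1 \<Turnstile> \<phi> \<longleftrightarrow> suffix w 1 \<Turnstile> \<phi>" if "1 < wlen v" "1 < wlen w"
    proof -
      have "suffix v 1 \<in> words AP" "suffix w 1 \<in> words AP"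
        using that v w by (auto intro: suffix_word(1))
      moreover have "\<forall>\<gamma><N. suffix v 1 \<gamma> = suffix w 1 \<gamma>" using eq by (simp add: suffix_def)
      ultimately show ?thesis using N(3) by blast
    qed
    ultimately show ?thesis by auto
  qed
  moreover have "0 < 1 + N" using 1 cord_zero_le[of 1] by (rule order_le_less_trans[rotated])
  ultimately show ?case
    using finite_lessThan_one_plus_cord[OF N(1)] by (intro exI[of _ "1 + N"]) blast
qed auto

lemma prefix_fin_word:
  assumes w: "w \<in> words AP" and N: "finite {..<N}"
  shows "w |` {..<N} \<in> fin_words AP"
proof -
  have d: "dom (w |` {..<N}) = {..<min N (wlen w)}"
    using dom_word[OF w] by auto
  have "ran (w |` {..<N}) \<subseteq> ran w" by (auto simp: ran_def restrict_map_def split: if_splits)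
  with w d have "w |` {..<N} \<in> words AP" by (auto simp: words_def)
  moreover have "finite {..<min N (wlen w)}"
    by (rule finite_subset[OF _ N]) auto
  ultimately show ?thesis by (simp add: fin_words_def wlen_eq[OF d])
qed

lemma lang_subset_Next:
  assumes \<phi>: "\<phi> \<in> LTL {CNext, CAnd, CNeg} AP" and \<psi>: "\<psi> \<in> LTL {CNext, CAnd, CNeg} AP"
    and fin: "lang AP \<phi> \<inter> fin_words AP \<subseteq> lang AP \<psi>"
  shows "lang AP \<phi> \<subseteq> lang AP \<psi>"
proof
  fix w assume "w \<in> lang AP \<phi>"
  then have w: "w \<in> words AP" and sat: "w \<Turnstile> \<phi>" by (auto simp: lang_def)
  \<comment> \<open>A word violating the inclusion is a model of this single formula, so one bound
    serves both \<phi> and \<psi>, and the finite prefix of such a word would violate the inclusion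
    too.\<close>
  have "And \<phi> (Neg \<psi>) \<in> LTL {CNext, CAnd, CNeg} AP"
    using \<phi> \<psi> by (intro LTL.intros) auto
  then obtain N where N: "finite {..<N}"
      "\<forall>v\<in>words AP. \<forall>w\<in>words AP. (\<forall>\<gamma><N. v \<gamma> = w \<gamma>) \<longrightarrow>
        (v \<Turnstile> And \<phi> (Neg \<psi>) \<longleftrightarrow> w \<Turnstile> And \<phi> (Neg \<psi>))"
    using sat_finite_prefix by blast
  define v where "v = w |` {..<N}"
  have v: "v \<in> fin_words AP" unfolding v_def by (rule prefix_fin_word[OF w N(1)])
  then have vw: "v \<in> words AP" by (simp add: fin_words_def)
  have "\<not> v \<Turnstile> And \<phi> (Neg \<psi>)" using fin v vw by (auto simp: lang_def)
  moreover have "v \<Turnstile> And \<phi> (Neg \<psi>) \<longleftrightarrow> w \<Turnstile> And \<phi> (Neg \<psi>)"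
    by (rule N(2)[rule_format, OF vw w]) (simp add: v_def)
  ultimately show "w \<in> lang AP \<psi>" using sat w by (auto simp: lang_def)
qed

theorem theorem7:
  fixes AP :: "'a set"
  assumes "finite AP"
  shows "(\<forall>\<phi> \<in> LTL {CFhat, CAnd, COr, CTop, CBot} AP. \<forall>\<psi> \<in> LTL {CFhat, CAnd, COr, CTop, CBot} AP.
            lang AP \<phi> = lang AP \<psi> \<longleftrightarrow> lang AP \<phi> \<inter> fin_words AP = lang AP \<psi> \<inter> fin_words AP) \<and>
         (\<forall>\<phi> \<in> LTL {CNext, CAnd, CNeg} AP. \<forall>\<psi> \<in> LTL {CNext, CAnd, CNeg} AP.
            lang AP \<phi> = lang AP \<psi> \<longleftrightarrow> lang AP \<phi> \<inter> fin_words AP = lang AP \<psi> \<inter> fin_words AP)"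
proof (intro conjI ballI iffI)
  fix \<phi> \<psi> :: "'a ltl"
  assume "\<phi> \<in> LTL {CFhat, CAnd, COr, CTop, CBot} AP"
    "\<psi> \<in> LTL {CFhat, CAnd, COr, CTop, CBot} AP"
    "lang AP \<phi> \<inter> fin_words AP = lang AP \<psi> \<inter> fin_words AP"
  \<comment> \<open>Equality on finite words yields the finite inclusion in both directions, and
    each extends to all words.\<close>
  then show "lang AP \<phi> = lang AP \<psi>" by (intro equalityI lang_subset_Fhat) auto
next
  fix \<phi> \<psi> :: "'a ltl"
  assume "\<phi> \<in> LTL {CNext, CAnd, CNeg} AP" "\<psi> \<in> LTL {CNext, CAnd, CNeg} AP"
    "lang AP \<phi> \<inter> fin_words AP = lang AP \<psi> \<inter> fin_words AP"
  then show "lang AP \<phi> = lang AP \<psi>" by (intro equalityI lang_subset_Next) auto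
qed simp_all

end
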